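(* Let $\Gamma$ be a free abelian group of finite rank, let $M$ be a path-connected topological space and let $(Z_x,\mathfrak r_x,\mathfrak s_x)_{x\in M}$ be a continuous family of stable supports on $M$. Let $Q:\Gamma_{\mathbb R}\to\mathbb R$ be a quadratic form that is negative semi-definite on $\operatorname{Ker}(Z_x:\Gamma_{\mathbb R}\to\mathbb C)$ for all $x\in M$ and such that there exists $x\in M$ satisfying $Q(\gamma)\ge 0$ for all $\gamma\in\mathfrak s_x$. Then $Q(\gamma)\ge0$ for all $y\in M$ and all $\gamma\in\mathfrak s_y$.
   Context: $\Gamma_{\mathbb R}=\Gamma\otimes_{\mathbb Z}\mathbb R$ is equipped with a norm $\|\cdot\|$. Linear maps $Z:\Gamma\to\mathbb C$ are extended $\mathbb R$-linearly to $\Gamma_{\mathbb R}$. A ray in $\mathbb C$ is a set $\mathbb R_{>0}z$ with $z\ne0$. For a subset $A$ of $\Gamma$, $\operatorname{sgr}(A)=\{a_1+\dots+a_k : a_i\in A,\ k\ge1\}$ is the semigroup generated by $A$. A stable support is a triple $(Z,\mathfrak r,\mathfrak s)$, where $Z:\Gamma\to\mathbb C$ is a linear map and $\mathfrak r\subset\mathfrak s\subset\Gamma\setminus\{0\}$ are subsets such that, for some $\varepsilon>0$, $\mathfrak s\subset\{\gamma\in\Gamma : |Z(\gamma)|\ge\varepsilon\|\gamma\|\}$, and such that for every ray $\ell\subset\mathbb C$ we have $\mathfrak s\cap Z^{-1}(\ell)\subset\operatorname{sgr}(\mathfrak r\cap Z^{-1}(\ell))$. A continuous family of stable supports on a topological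 space $M$ is a collection of stable supports $(Z_x,\mathfrak r_x,\mathfrak s_x)_{x\in M}$ such that the map $M\to\operatorname{Hom}(\Gamma,\mathbb C)$, $x\mapsto Z_x$, is continuous and (1) for any $x\in M$ there exist $\varepsilon>0$ and an open set $x\in U\subset M$ such that $\mathfrak s_y\subset\{\gamma\in\Gamma : |Z_y(\gamma)|\ge\varepsilon\|\gamma\|\}$ for all $y\in U$; (2) for any $\gamma\in\Gamma$, the set $\{x\in M:\gamma\in\mathfrak r_x\}$ is open; (3) for any $\gamma\in\Gamma$, the set $\{x\in M:\gamma\in\mathfrak s_x\}$ is closed. *)

theory Defs
  imports "HOL-Analysis.Analysis"
begin

text \<open>An abelian group is a module over the integers; the locale \<^locale>\<open>module\<close> then supplies
  \<open>Z.span\<close> and \<open>Z.dependent\<close>.\<close>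

definition zscale :: "int \<Rightarrow> 'g::ab_group_add \<Rightarrow> 'g"
  where "zscale k x = (\<Sum>i<nat k. x) - (\<Sum>i<nat (- k). x)"

lemma zscale_add1: "zscale (k + 1) x = zscale k x + x"
proof (cases "k \<ge> 0")
  case True
  then have "nat (k + 1) = Suc (nat k)" by simp
  with True show ?thesis by (simp add: zscale_def)
next
  case False
  then have "nat (- k) = Suc (nat (- (k + 1)))" by simp
  with False show ?thesis by (simp add: zscale_def)
qed

lemma zscale_0: "zscale 0 x = 0"
  by (simp add: zscale_def)

lemma zscale_diff1: "zscale (k - 1) x = zscale k x - x"
  using zscale_add1[of "k - 1" x] by simp

lemma zscale_1: "zscale 1 x = x"
  by (simp add: zscale_def)

global_interpretation Z: module zscale
proof
  fix a b :: int and x y :: 'a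
  show "zscale a (x + y) = zscale a x + zscale a y"
    by (simp add: zscale_def sum.distrib)
  show add: "zscale (a + b) x = zscale a x + zscale b x" for a b :: int and x :: 'a
  proof (induction b rule: int_induct[where k = 0])
    case (step1 i)
    then show ?case using zscale_add1[of "a + i" x] by (simp add: zscale_add1 add.assoc)
  next
    case (step2 i)
    then show ?case using zscale_diff1[of "a + i" x]
      by (simp add: zscale_diff1 add_diff_eq)
  qed (simp add: zscale_0)
  show "zscale a (zscale b x) = zscale (a * b) x"
  proof (induction a rule: int_induct[where k = 0])
    case (step1 i)
    then show ?case by (simp add: zscale_add1 distrib_right add zscale_1)
  next
    case (step2 i)
    then show ?case
      using add[of "i * b - b" b x] by (simp add: zscale_diff1 left_diff_distrib)
  qed (simp add: zscale_0)
  show "zscale 1 x = x"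
    by (rule zscale_1)
qed

definition free_of_finite_rank :: "'g::ab_group_add itself \<Rightarrow> bool"
  where "free_of_finite_rank _ \<longleftrightarrow>
    (\<exists>B::'g set. finite B \<and> \<not> Z.dependent B \<and> Z.span B = UNIV)"

text \<open>The real vector space \<open>\<Gamma> \<otimes> \<real>\<close> is given, up to unique isomorphism, by a space \<open>'v\<close> and a map
  \<open>\<iota> \<gamma> = \<gamma> \<otimes> 1\<close> with the universal property of the extension of scalars. The definition states
  the universal property only for maps into the reals; by \<open>realification_universal\<close> below this
  already implies it for maps into every real vector space. A norm on \<open>\<Gamma> \<otimes> \<real>\<close> is then the norm of
  an instance \<open>'v::real_normed_vector\<close>.\<close>

definition is_realification :: "('g::ab_group_add \<Rightarrow> 'v::real_vector) \<Rightarrow> bool"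
  where "is_realification \<iota> \<longleftrightarrow> Modules.additive \<iota> \<and>
    (\<forall>f::'g \<Rightarrow> real. Modules.additive f \<longrightarrow> (\<exists>!g. linear g \<and> (\<forall>\<gamma>. g (\<iota> \<gamma>) = f \<gamma>)))"

definition real_extension :: "('g \<Rightarrow> 'v) \<Rightarrow> ('g \<Rightarrow> 'w) \<Rightarrow> 'v::real_vector \<Rightarrow> 'w::real_vector"
  where "real_extension \<iota> f = (THE g. linear g \<and> (\<forall>\<gamma>. g (\<iota> \<gamma>) = f \<gamma>))"

lemma realification_span:
  fixes \<iota> :: "'g::ab_group_add \<Rightarrow> 'v::real_vector"
  assumes "is_realification \<iota>"
  shows "span (range \<iota>) = UNIV"
proof (rule ccontr)
  assume "span (range \<iota>) \<noteq> UNIV"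
  then obtain v where v: "v \<notin> span (range \<iota>)" by auto
  obtain B where B: "B \<subseteq> range \<iota>" "independent B" "range \<iota> \<subseteq> span B"
    using maximal_independent_subset by blast
  have vB: "v \<notin> span B"
    using v B(1) span_mono by blast
  then have "independent (insert v B)"
    using B(2) independent_insertI by blast
  then obtain g :: "'v \<Rightarrow> real" where g: "linear g" "\<forall>x\<in>insert v B. g x = (if x = v then 1 else 0)"
    using linear_independent_extend[of "insert v B" "\<lambda>x. if x = v then 1 else 0"] by blast
  have vB': "v \<notin> B" using vB span_base by blast
  have "g x = 0" if "x \<in> span B" for x
    by (rule linear_eq_0_on_span[OF g(1) _ that]) (use g(2) vB' in auto)
  then have 1: "\<forall>\<gamma>. g (\<iota> \<gamma>) = 0" using B(3) by blast
  have "\<exists>!g. linear g \<and> (\<forall>\<gamma>. g (\<iota> \<gamma>) = (0::real))"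
    using assms unfolding is_realification_def
    by (auto dest!: spec[of _ "\<lambda>_. 0"] simp: Modules.additive_def)
  moreover have "linear (\<lambda>_::'v. 0::real)" by (simp add: linear_iff)
  ultimately have "g = (\<lambda>_. 0)" using 1 g(1) by blast
  then show False using g(2) by simp
qed

lemma realification_universal:
  fixes \<iota> :: "'g::ab_group_add \<Rightarrow> 'v::real_vector" and f :: "'g \<Rightarrow> 'w::real_vector"
  assumes "is_realification \<iota>" and f: "Modules.additive f"
  shows "\<exists>!g. linear g \<and> (\<forall>\<gamma>. g (\<iota> \<gamma>) = f \<gamma>)"
proof -
  note sp = realification_span[OF assms(1)]
  obtain B where B: "B \<subseteq> range \<iota>" "independent B" "range \<iota> \<subseteq> span B"
    using maximal_independent_subset by blast
  define s where "s b = (SOME \<gamma>. \<iota> \<gamma> = b)" for b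
  have s: "\<iota> (s b) = b" if "b \<in> B" for b
  proof -
    have "\<exists>\<gamma>. \<iota> \<gamma> = b" using that B(1) by auto
    then show ?thesis unfolding s_def by (rule someI_ex)
  qed
  obtain g :: "'v \<Rightarrow> 'w" where g: "linear g" "\<forall>b\<in>B. g b = f (s b)"
    using linear_independent_extend[OF B(2), of "\<lambda>b. f (s b)"] by blast
  have "g (\<iota> \<gamma>) = f \<gamma>" for \<gamma>
  proof (rule ccontr)
    assume "g (\<iota> \<gamma>) \<noteq> f \<gamma>"
    then have "independent {g (\<iota> \<gamma>) - f \<gamma>}" by simp
    then obtain p :: "'w \<Rightarrow> real" where p: "linear p" "p (g (\<iota> \<gamma>) - f \<gamma>) = 1"
      using linear_independent_extend[of "{g (\<iota> \<gamma>) - f \<gamma>}" "\<lambda>_. 1::real"] by auto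
    have "Modules.additive (\<lambda>\<gamma>. p (f \<gamma>))"
      using f p(1) by (simp add: Modules.additive_def linear_add)
    then obtain h where h: "linear h" "\<forall>\<gamma>. h (\<iota> \<gamma>) = p (f \<gamma>)"
      using assms(1) unfolding is_realification_def by blast
    have "h b = (p \<circ> g) b" if "b \<in> B" for b
      using h(2) s[OF that] g(2) that by (metis comp_apply)
    then have "h (\<iota> \<gamma>) = (p \<circ> g) (\<iota> \<gamma>)"
      using linear_eq_on_span[OF h(1) linear_compose[OF g(1) p(1)]] B(3) by blast
    then show False using h(2) p by (simp add: linear_diff)
  qed
  then have "\<exists>g. linear g \<and> (\<forall>\<gamma>. g (\<iota> \<gamma>) = f \<gamma>)" using g(1) by blast
  moreover have "g = h" if "linear g" "\<forall>\<gamma>. g (\<iota> \<gamma>) = f \<gamma>" "linear h" "\<forall>\<gamma>. h (\<iota> \<gamma>) = f \<gamma>"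
    for g h :: "'v \<Rightarrow> 'w"
  proof
    fix v :: 'v
    show "g v = h v"
      by (rule linear_eq_on_span[OF that(1,3), of "range \<iota>"]) (use that sp in auto)
  qed
  ultimately show ?thesis by blast
qed

definition is_ray :: "complex set \<Rightarrow> bool"
  where "is_ray l \<longleftrightarrow> (\<exists>z. z \<noteq> 0 \<and> l = {t *\<^sub>R z |t. t > 0})"

definition sgr :: "'g::ab_group_add set \<Rightarrow> 'g set"
  where "sgr A = {sum_list as |as. as \<noteq> [] \<and> set as \<subseteq> A}"

definition stable_support ::
    "('g::ab_group_add \<Rightarrow> 'v::real_normed_vector) \<Rightarrow> ('g \<Rightarrow> complex) \<Rightarrow> 'g set \<Rightarrow> 'g set \<Rightarrow> bool"
  where "stable_support \<iota> Z r s \<longleftrightarrow>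
    Modules.additive Z \<and> r \<subseteq> s \<and> s \<subseteq> UNIV - {0} \<and>
    (\<exists>\<epsilon>>0. s \<subseteq> {\<gamma>. cmod (Z \<gamma>) \<ge> \<epsilon> * norm (\<iota> \<gamma>)}) \<and>
    (\<forall>l. is_ray l \<longrightarrow> s \<inter> Z -` l \<subseteq> sgr (r \<inter> Z -` l))"

text \<open>Continuity of \<open>x \<mapsto> Z x\<close> refers to the product topology on the function type, that is, to
  pointwise convergence. On the finite-dimensional space of homomorphisms from a free abelian
  group of finite rank to the complex numbers, this is the usual topology.\<close>

definition continuous_family ::
    "('g::ab_group_add \<Rightarrow> 'v::real_normed_vector) \<Rightarrow> ('m::topological_space \<Rightarrow> 'g \<Rightarrow> complex) \<Rightarrow>
      ('m \<Rightarrow> 'g set) \<Rightarrow> ('m \<Rightarrow> 'g set) \<Rightarrow> bool"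
  where "continuous_family \<iota> Z r s \<longleftrightarrow>
    (\<forall>x. stable_support \<iota> (Z x) (r x) (s x)) \<and>
    continuous_on UNIV Z \<and>
    (\<forall>x. \<exists>\<epsilon>>0. \<exists>U. open U \<and> x \<in> U \<and>
      (\<forall>y\<in>U. s y \<subseteq> {\<gamma>. cmod (Z y \<gamma>) \<ge> \<epsilon> * norm (\<iota> \<gamma>)})) \<and>
    (\<forall>\<gamma>. open {x. \<gamma> \<in> r x}) \<and>
    (\<forall>\<gamma>. closed {x. \<gamma> \<in> s x})"

definition quadratic_form :: "('v::real_vector \<Rightarrow> real) \<Rightarrow> bool"
  where "quadratic_form Q \<longleftrightarrow>
    (\<exists>b. bilinear b \<and> (\<forall>v w. b v w = b w v) \<and> (\<forall>v. Q v = b v v))"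

definition negative_semidefinite_on :: "'v set \<Rightarrow> ('v \<Rightarrow> real) \<Rightarrow> bool"
  where "negative_semidefinite_on S Q \<longleftrightarrow> (\<forall>v\<in>S. Q v \<le> 0)"

end

theory Submission
  imports Defs
begin

text \<open>Call a point bad if its support contains some \<open>\<gamma>\<close> with \<open>Q \<gamma> < 0\<close>. On each ray the vectors with
  \<open>Q \<ge> 0\<close> form a convex cone, so a bad \<open>\<gamma> \<in> s x\<close> is a sum of elements of \<open>r x\<close> on its ray, one of
  which is bad too. Near a fixed point \<open>x\<close>, where \<open>Z y\<close> is close to \<open>Z x\<close> on the supports, elements
  on a common ray of \<open>Z y\<close> have images under \<open>Z x\<close> at acute angles, so the summand \<open>a\<close> satisfies
  \<open>\<bar>Z x a\<bar> \<le> \<bar>Z x \<gamma>\<bar>\<close>. Hence near \<open>x\<close> the bad points witnessed by one of the finitely many \<open>\<gamma>\<close> with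
  \<open>\<bar>Z x \<gamma>\<bar> \<le> c\<close> form a set that is closed, because \<open>s\<close> is, and open, because \<open>r\<close> is. On a small
  piece of a path, therefore, all points are bad or none is. Sizes are measured with the
  fixed \<open>Z x\<close> because the central charge may have infinite variation along the path.\<close>

section \<open>Finite-dimensional normed spaces\<close>

text \<open>The norm of a combination depends continuously on its coefficients, so it attains a
  minimum on the compact sphere of the maximum norm, and independence makes that minimum positive.
  Homogeneity carries the bound to all coefficients. Consequently coordinates are controlled by
  whatever norm the space carries.\<close>

lemma independent_coefficients_bound:
  fixes B :: "'v::real_normed_vector set"
  assumes "finite B" and "independent B"
  obtains c where "c > 0" and "\<And>u b. b \<in> B \<Longrightarrow> c * \<bar>u b\<bar> \<le> norm (\<Sum>a\<in>B. u a *\<^sub>R a)"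
proof (cases "B = {}")
  case True
  show ?thesis by (rule that[of 1]) (use True in auto)
next
  case False
  \<comment> \<open>\<open>PiE UNIV (S b)\<close> is the pair of faces of the cube where the
    coefficient of \<open>b\<close> is 1 or -1, so \<open>K\<close> is the boundary of the cube.
    Coefficients off \<open>B\<close> are pinned to 0, which makes the product over the whole type
    compact in the product topology on functions.\<close>
  define S :: "'v \<Rightarrow> 'v \<Rightarrow> real set"
    where "S b a = (if a = b then {-1, 1} else if a \<in> B then {-1..1} else {0})" for b a
  define K where "K = (\<Union>b\<in>B. PiE UNIV (S b))"
  have "compact (PiE UNIV (S b))" for b
  proof -
    have "compactin (product_topology (\<lambda>_. euclidean) UNIV) (PiE UNIV (S b))"
      by (subst compactin_PiE) (auto simp: S_def)
    then show ?thesis by (simp add: euclidean_product_topology)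
  qed
  then have "compact K" unfolding K_def using \<open>finite B\<close> by (intro compact_UN) auto
  moreover have "K \<noteq> {}"
  proof -
    obtain b where "b \<in> B" using False by blast
    moreover have "(\<lambda>a. if a = b then 1 else 0) \<in> PiE UNIV (S b)" by (auto simp: S_def)
    ultimately show ?thesis unfolding K_def by blast
  qed
  moreover have "continuous_on K (\<lambda>u. norm (\<Sum>a\<in>B. u a *\<^sub>R a))"
    by (rule continuous_on_subset[OF _ subset_UNIV])
      (intro continuous_on_norm continuous_on_sum continuous_on_scaleR
        continuous_on_product_coordinates continuous_on_const)
  ultimately have "\<exists>w\<in>K. \<forall>u\<in>K. norm (\<Sum>a\<in>B. w a *\<^sub>R a) \<le> norm (\<Sum>a\<in>B. u a *\<^sub>R a)"
    by (rule continuous_attains_inf)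
  then obtain w where w: "w \<in> K"
    and min: "\<And>u. u \<in> K \<Longrightarrow> norm (\<Sum>a\<in>B. w a *\<^sub>R a) \<le> norm (\<Sum>a\<in>B. u a *\<^sub>R a)"
    by blast
  define c where "c = norm (\<Sum>a\<in>B. w a *\<^sub>R a)"
  have "c > 0"
  proof -
    obtain b where b: "b \<in> B" "w \<in> PiE UNIV (S b)" using w by (auto simp: K_def)
    then have "w b \<in> S b b" by blast
    then have "w b \<noteq> 0" by (auto simp: S_def)
    then have "(\<Sum>a\<in>B. w a *\<^sub>R a) \<noteq> 0"
      using \<open>independent B\<close> \<open>finite B\<close> b(1) by (auto simp: dependent_finite)
    then show ?thesis by (simp add: c_def)
  qed
  moreover have "c * \<bar>u b\<bar> \<le> norm (\<Sum>a\<in>B. u a *\<^sub>R a)" if "b \<in> B" for u b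
  proof -
    define m where "m = Max ((\<lambda>a. \<bar>u a\<bar>) ` B)"
    have le_m: "\<bar>u a\<bar> \<le> m" if "a \<in> B" for a
      using that \<open>finite B\<close> by (simp add: m_def)
    have "m \<in> (\<lambda>a. \<bar>u a\<bar>) ` B"
      unfolding m_def using \<open>finite B\<close> False by (intro Max_in) auto
    then obtain d where d: "d \<in> B" "\<bar>u d\<bar> = m" by auto
    show ?thesis
    proof (cases "m = 0")
      case True
      then show ?thesis using le_m[OF that] by simp
    next
      case False
      then have m: "m > 0" using d by linarith
      \<comment> \<open>Division by the largest modulus \<open>m\<close>, attained at
        \<open>d\<close>, puts the coefficients on a face belonging to \<open>d\<close>; the minimum
        \<open>c\<close> on \<open>K\<close> then scales back by \<open>m\<close>.\<close>
      define u' where "u' a = (if a \<in> B then u a / m else 0)" for a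
      have "u' a \<in> S d a" for a
      proof -
        have "- 1 \<le> u a / m \<and> u a / m \<le> 1" if "a \<in> B"
          using le_m[OF that] m by (simp add: field_simps abs_le_iff)
        moreover have "u d / m = 1 \<or> u d / m = - 1"
          using d(2) m by (simp add: field_simps abs_if split: if_splits)
        ultimately show ?thesis using d(1) by (auto simp: u'_def S_def)
      qed
      then have "u' \<in> K" unfolding K_def using d(1) by blast
      then have "c \<le> norm (\<Sum>a\<in>B. u' a *\<^sub>R a)" unfolding c_def by (rule min)
      also have "(\<Sum>a\<in>B. u' a *\<^sub>R a) = (1 / m) *\<^sub>R (\<Sum>a\<in>B. u a *\<^sub>R a)"
        by (simp add: scaleR_sum_right u'_def)
      finally have "c * m \<le> norm (\<Sum>a\<in>B. u a *\<^sub>R a)"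
        using m by (simp add: field_simps)
      moreover have "c * \<bar>u b\<bar> \<le> c * m" using le_m[OF that] \<open>c > 0\<close> by simp
      ultimately show ?thesis by linarith
    qed
  qed
  ultimately show ?thesis by (rule that)
qed

text \<open>In a basis extracted from \<open>S\<close> every coordinate of \<open>v\<close> is at
  most \<open>norm v / c\<close>, so the images of the basis vectors bound \<open>f\<close>.\<close>

lemma linear_imp_bounded_linear_finite_dimensional:
  fixes f :: "'v::real_normed_vector \<Rightarrow> 'w::real_normed_vector"
  assumes "linear f" and "finite (S :: 'v set)" and "span S = UNIV"
  shows "bounded_linear f"
proof -
  obtain B :: "'v set" where B: "B \<subseteq> S" "independent B" "S \<subseteq> span B"
    using maximal_independent_subset by blast
  have "finite B" using B(1) assms(2) by (rule finite_subset)
  have "span B = UNIV" using B(3) assms(3) by (metis span_mono span_span top.extremum_uniqueI)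
  obtain c where c: "c > 0" "\<And>u b. b \<in> B \<Longrightarrow> c * \<bar>u b\<bar> \<le> norm (\<Sum>a\<in>B. u a *\<^sub>R a)"
    using independent_coefficients_bound[OF \<open>finite B\<close> B(2)] by blast
  have "norm (f v) \<le> norm v * (\<Sum>b\<in>B. norm (f b) / c)" for v
  proof -
    define u where "u = representation B v"
    have v: "v = (\<Sum>b\<in>B. u b *\<^sub>R b)"
      unfolding u_def using sum_representation_eq[OF B(2) _ \<open>finite B\<close>] \<open>span B = UNIV\<close> by simp
    have "norm (f v) \<le> (\<Sum>b\<in>B. \<bar>u b\<bar> * norm (f b))"
      by (subst v) (auto simp: linear_sum[OF assms(1)] linear_scale[OF assms(1)]
          intro!: order_trans[OF norm_sum])
    also have "\<dots> \<le> (\<Sum>b\<in>B. norm v / c * norm (f b))"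
    proof (intro sum_mono mult_right_mono)
      fix b assume "b \<in> B"
      then show "\<bar>u b\<bar> \<le> norm v / c"
        using c(1) c(2)[of b u] by (simp add: v[symmetric] field_simps)
    qed simp
    finally show ?thesis by (simp add: sum_distrib_left)
  qed
  then show ?thesis
    using assms(1) by (intro bounded_linear_intro) (auto simp: linear_add linear_scale)
qed

section \<open>The lattice in its realification\<close>

lemma additive_zscale:
  fixes f :: "'g::ab_group_add \<Rightarrow> 'w::real_vector"
  assumes "Modules.additive f"
  shows "f (zscale k x) = of_int k *\<^sub>R f x"
proof -
  interpret additive f by fact
  show ?thesis
    by (cases "k \<ge> 0") (simp_all add: zscale_def diff minus sum scaleR_conv_of_real sum_constant_scaleR)
qed

lemma realification_bounded_coordinates:
  fixes \<iota> :: "'g::ab_group_add \<Rightarrow> 'v::real_normed_vector"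
  assumes "free_of_finite_rank TYPE('g)" and "is_realification \<iota>"
  obtains B :: "'g set" and f :: "'g \<Rightarrow> 'g \<Rightarrow> int" and K :: real
  where "finite B" and "\<And>\<gamma>. (\<Sum>b\<in>B. zscale (f \<gamma> b) b) = \<gamma>"
    and "K > 0" and "\<And>\<gamma> b. b \<in> B \<Longrightarrow> \<bar>real_of_int (f \<gamma> b)\<bar> \<le> K * norm (\<iota> \<gamma>)"
proof -
  obtain B :: "'g set" where B: "finite B" "\<not> Z.dependent B" "Z.span B = UNIV"
    using assms(1) unfolding free_of_finite_rank_def by blast
  define f where "f = Z.representation B"
  have f: "(\<Sum>b\<in>B. zscale (f \<gamma> b) b) = \<gamma>" for \<gamma>
    unfolding f_def using Z.sum_representation_eq[OF B(2) _ B(1)] B(3) by simp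
  have add_\<iota>: "Modules.additive \<iota>" using assms(2) by (simp add: is_realification_def)
  have "range \<iota> \<subseteq> span (\<iota> ` B)"
  proof safe
    fix \<gamma>
    have "\<iota> \<gamma> = (\<Sum>b\<in>B. \<iota> (zscale (f \<gamma> b) b))"
      by (subst (1) f[symmetric]) (rule additive.sum[OF add_\<iota>])
    also have "\<dots> = (\<Sum>b\<in>B. of_int (f \<gamma> b) *\<^sub>R \<iota> b)" by (simp add: additive_zscale[OF add_\<iota>])
    also have "\<dots> \<in> span (\<iota> ` B)" by (intro span_sum span_scale span_base) auto
    finally show "\<iota> \<gamma> \<in> span (\<iota> ` B)" .
  qed
  then have span: "span (\<iota> ` B) = UNIV"
    using realification_span[OF assms(2)] by (metis span_mono span_span top.extremum_uniqueI)
  have "\<exists>K. \<forall>\<gamma>. \<bar>real_of_int (f \<gamma> b)\<bar> \<le> K * norm (\<iota> \<gamma>)" for b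
  proof -
    have "Modules.additive (\<lambda>\<gamma>. real_of_int (f \<gamma> b))"
      unfolding Modules.additive_def f_def using B by (simp add: Z.representation_add)
    then obtain g :: "'v \<Rightarrow> real" where g: "linear g" "\<forall>\<gamma>. g (\<iota> \<gamma>) = real_of_int (f \<gamma> b)"
      using assms(2) unfolding is_realification_def by blast
    have "bounded_linear g"
      using linear_imp_bounded_linear_finite_dimensional[OF g(1) _ span] B(1) by simp
    then obtain K where "\<And>v. norm (g v) \<le> norm v * K"
      using bounded_linear.bounded by blast
    then show ?thesis using g(2) by (metis mult.commute real_norm_def)
  qed
  then obtain k where k: "\<And>b \<gamma>. \<bar>real_of_int (f \<gamma> b)\<bar> \<le> k b * norm (\<iota> \<gamma>)" by metis
  \<comment> \<open>The sum dominates all \<open>k b\<close> at once; the summand 1 keeps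
    \<open>K\<close> positive even for empty \<open>B\<close>, since \<open>K\<close> is a divisor
    later.\<close>
  define K where "K = 1 + (\<Sum>b\<in>B. \<bar>k b\<bar>)"
  have "K > 0" unfolding K_def by (simp add: add_pos_nonneg sum_nonneg)
  moreover have "\<bar>real_of_int (f \<gamma> b)\<bar> \<le> K * norm (\<iota> \<gamma>)" if "b \<in> B" for \<gamma> b
  proof -
    have "\<bar>k b\<bar> \<le> (\<Sum>b\<in>B. \<bar>k b\<bar>)" using B(1) that by (intro member_le_sum) auto
    then have "k b \<le> K" by (simp add: K_def)
    then show ?thesis using k[of \<gamma> b] by (meson mult_right_mono norm_ge_zero order_trans)
  qed
  ultimately show ?thesis using that[of B f K] B(1) f by blast
qed

text \<open>A bound on the norm bounds all integer coordinates, which leaves finitely many choices.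
  This is the source of finiteness in the closedness argument of the main proof.\<close>

lemma realification_discrete:
  fixes \<iota> :: "'g::ab_group_add \<Rightarrow> 'v::real_normed_vector"
  assumes "free_of_finite_rank TYPE('g)" and "is_realification \<iota>"
  shows "finite {\<gamma>. norm (\<iota> \<gamma>) \<le> R}"
proof -
  obtain B :: "'g set" and f :: "'g \<Rightarrow> 'g \<Rightarrow> int" and K :: real
    where B: "finite B" "\<And>\<gamma>. (\<Sum>b\<in>B. zscale (f \<gamma> b) b) = \<gamma>"
      and K: "K > 0" "\<And>\<gamma> b. b \<in> B \<Longrightarrow> \<bar>real_of_int (f \<gamma> b)\<bar> \<le> K * norm (\<iota> \<gamma>)"
    using realification_bounded_coordinates[OF assms] by blast
  define N where "N = \<lceil>K * R\<rceil>"
  have "{\<gamma>. norm (\<iota> \<gamma>) \<le> R} \<subseteq> (\<lambda>u. \<Sum>b\<in>B. zscale (u b) b) ` PiE B (\<lambda>_. {-N..N})"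
  proof safe
    fix \<gamma> assume R: "norm (\<iota> \<gamma>) \<le> R"
    have "f \<gamma> b \<in> {-N..N}" if "b \<in> B" for b
    proof -
      have "\<bar>real_of_int (f \<gamma> b)\<bar> \<le> K * R"
        using K(2)[OF that, of \<gamma>] mult_left_mono[OF R, of K] K(1) by linarith
      then show ?thesis by (simp add: N_def) linarith
    qed
    then have "restrict (f \<gamma>) B \<in> PiE B (\<lambda>_. {-N..N})" by auto
    moreover have "\<gamma> = (\<Sum>b\<in>B. zscale (restrict (f \<gamma>) B b) b)"
      using B(2)[of \<gamma>] by (simp cong: sum.cong)
    ultimately show "\<gamma> \<in> (\<lambda>u. \<Sum>b\<in>B. zscale (u b) b) ` PiE B (\<lambda>_. {-N..N})" by blast
  qed
  then show ?thesis by (rule finite_subset) (intro finite_imageI finite_PiE B(1), simp)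
qed

text \<open>Upgrades pointwise continuity to an estimate uniform in \<open>\<gamma>\<close>,
  relative to the norm: closeness on the finite basis suffices because the coordinates of
  \<open>\<gamma>\<close> are at most \<open>K * norm (\<iota> \<gamma>)\<close>.\<close>

lemma eventually_central_charge_close:
  fixes \<iota> :: "'g::ab_group_add \<Rightarrow> 'v::real_normed_vector"
    and Z :: "'m::topological_space \<Rightarrow> 'g \<Rightarrow> complex"
  assumes "free_of_finite_rank TYPE('g)" and "is_realification \<iota>"
    and add: "\<And>x. Modules.additive (Z x)"
    and cont: "continuous_on UNIV Z" and "\<kappa> > 0"
  obtains U where "open U" and "x \<in> U"
    and "\<And>y \<gamma>. y \<in> U \<Longrightarrow> cmod (Z y \<gamma> - Z x \<gamma>) \<le> \<kappa> * norm (\<iota> \<gamma>)"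
proof -
  obtain B :: "'g set" and f :: "'g \<Rightarrow> 'g \<Rightarrow> int" and K :: real
    where B: "finite B" "\<And>\<gamma>. (\<Sum>b\<in>B. zscale (f \<gamma> b) b) = \<gamma>"
      and K: "K > 0" "\<And>\<gamma> b. b \<in> B \<Longrightarrow> \<bar>real_of_int (f \<gamma> b)\<bar> \<le> K * norm (\<iota> \<gamma>)"
    using realification_bounded_coordinates[OF assms(1,2)] by blast
  define U where "U = {y. (\<Sum>b\<in>B. cmod (Z y b - Z x b)) < \<kappa> / K}"
  have "continuous_on UNIV (\<lambda>y. \<Sum>b\<in>B. cmod (Z y b - Z x b))"
    by (intro continuous_intros continuous_on_product_then_coordinatewise[OF cont])
  then have "open U" unfolding U_def by (intro open_Collect_less) auto
  moreover have "x \<in> U" using \<open>\<kappa> > 0\<close> K(1) by (simp add: U_def)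
  moreover have "cmod (Z y \<gamma> - Z x \<gamma>) \<le> \<kappa> * norm (\<iota> \<gamma>)" if "y \<in> U" for y \<gamma>
  proof -
    have Z: "Z x \<gamma> = (\<Sum>b\<in>B. of_int (f \<gamma> b) *\<^sub>R Z x b)" for x
    proof -
      have "Z x \<gamma> = (\<Sum>b\<in>B. Z x (zscale (f \<gamma> b) b))"
        by (subst (1) B(2)[symmetric]) (rule additive.sum[OF add])
      then show ?thesis by (simp add: additive_zscale[OF add])
    qed
    have "Z y \<gamma> - Z x \<gamma> = (\<Sum>b\<in>B. of_int (f \<gamma> b) *\<^sub>R (Z y b - Z x b))"
      unfolding Z by (simp add: sum_subtractf[symmetric] scaleR_diff_right)
    then have "cmod (Z y \<gamma> - Z x \<gamma>) \<le> (\<Sum>b\<in>B. \<bar>of_int (f \<gamma> b)\<bar> * cmod (Z y b - Z x b))"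
      by (metis (no_types, lifting) norm_scaleR norm_sum sum.cong)
    also have "\<dots> \<le> (\<Sum>b\<in>B. K * norm (\<iota> \<gamma>) * cmod (Z y b - Z x b))"
      by (intro sum_mono mult_right_mono K) auto
    also have "\<dots> = K * norm (\<iota> \<gamma>) * (\<Sum>b\<in>B. cmod (Z y b - Z x b))"
      by (simp add: sum_distrib_left)
    also have "\<dots> \<le> K * norm (\<iota> \<gamma>) * (\<kappa> / K)"
      using that K(1) by (intro mult_left_mono) (auto simp: U_def)
    finally show ?thesis using K(1) by (simp add: mult.commute)
  qed
  ultimately show ?thesis by (rule that)
qed

section \<open>Decompositions along a ray\<close>

text \<open>Two vectors over the same ray have positive multiples whose difference is killed by
  \<open>W\<close>. Since \<open>Q\<close> is nonpositive there, the mixed term \<open>b v w\<close>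
  cannot be negative, and adding the vectors preserves \<open>Q \<ge> 0\<close>.\<close>

lemma sum_list_on_ray_quadratic_nonneg:
  fixes Q :: "'v::real_vector \<Rightarrow> real" and W :: "'v \<Rightarrow> 'w::real_vector"
  assumes "quadratic_form Q" and "linear W" and neg: "negative_semidefinite_on {v. W v = 0} Q"
    and "vs \<noteq> []" and "\<And>v. v \<in> set vs \<Longrightarrow> Q v \<ge> 0"
    and "\<And>v. v \<in> set vs \<Longrightarrow> \<exists>t>0. W v = t *\<^sub>R z"
  shows "Q (sum_list vs) \<ge> 0"
proof -
  obtain b where b: "bilinear b" "\<And>v w. b v w = b w v" "\<And>v. Q v = b v v"
    using assms(1) unfolding quadratic_form_def by blast
  have Q_add: "Q (v + w) \<ge> 0"
    if "Q v \<ge> 0" "Q w \<ge> 0" "p > 0" "q > 0" "W v = p *\<^sub>R z" "W w = q *\<^sub>R z" for v w p q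
  proof -
    \<comment> \<open>Weights \<open>q\<close> and \<open>p\<close> cancel the images. Expanding
      \<open>Q\<close> on this kernel vector bounds \<open>2 * (p * q) * b v w\<close> below by a
      nonnegative quantity.\<close>
    have "W (q *\<^sub>R v - p *\<^sub>R w) = 0"
      using that assms(2) by (simp add: linear_diff linear_scale)
    then have "Q (q *\<^sub>R v - p *\<^sub>R w) \<le> 0" using neg by (simp add: negative_semidefinite_on_def)
    moreover have "Q (q *\<^sub>R v - p *\<^sub>R w) = q * q * Q v - 2 * (p * q) * b v w + p * p * Q w"
      using b by (simp add: bilinear_lsub bilinear_rsub bilinear_lmul bilinear_rmul algebra_simps)
    ultimately have "q * q * Q v + p * p * Q w \<le> 2 * (p * q) * b v w" by linarith
    moreover have "0 \<le> q * q * Q v + p * p * Q w" using that by simp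
    ultimately have "0 \<le> (p * q) * b v w" by linarith
    then have "b v w \<ge> 0" using mult_pos_pos[OF that(3,4)] by (simp add: zero_le_mult_iff)
    moreover have "Q (v + w) = Q v + 2 * b v w + Q w"
      using b by (simp add: bilinear_ladd bilinear_radd)
    ultimately show ?thesis using that by simp
  qed
  \<comment> \<open>The induction also carries the position on the ray, because \<open>Q_add\<close>
    needs it for the partial sum.\<close>
  have "Q (sum_list vs) \<ge> 0 \<and> (\<exists>t>0. W (sum_list vs) = t *\<^sub>R z)"
    using assms(4-6)
  proof (induction vs rule: list_nonempty_induct)
    case (single v)
    then show ?case by simp
  next
    case (cons v vs)
    have "Q (sum_list vs) \<ge> 0 \<and> (\<exists>t>0. W (sum_list vs) = t *\<^sub>R z)"
      by (rule cons.IH) (use cons.prems in auto)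
    moreover have "\<exists>t>0. W v = t *\<^sub>R z" "Q v \<ge> 0" using cons.prems by auto
    ultimately obtain p q where "p > 0" "q > 0" "W v = p *\<^sub>R z" "W (sum_list vs) = q *\<^sub>R z"
      and "Q v \<ge> 0" "Q (sum_list vs) \<ge> 0" by blast
    then have "Q (v + sum_list vs) \<ge> 0" "W (v + sum_list vs) = (p + q) *\<^sub>R z" "p + q > 0"
      using assms(2) Q_add[of v "sum_list vs" p q]
      by (auto simp: linear_add scaleR_add_left)
    then show ?case by auto
  qed
  then show ?thesis ..
qed

text \<open>Pair \<open>z\<close> with the sum: \<open>inner z z\<close> is one of the nonnegative
  terms, and Cauchy-Schwarz bounds the total by the product of the norms.\<close>

lemma norm_le_norm_sum_list:
  fixes zs :: "'a::real_inner list"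
  assumes "z \<in> set zs" and "\<And>x y. x \<in> set zs \<Longrightarrow> y \<in> set zs \<Longrightarrow> inner x y \<ge> 0"
  shows "norm z \<le> norm (sum_list zs)"
proof -
  have "inner z (sum_list zs) = (\<Sum>y\<leftarrow>zs. inner z y)"
    by (induction zs) (auto simp: inner_add_right)
  moreover have "inner z z \<le> (\<Sum>y\<leftarrow>zs. inner z y)"
    using assms by (intro member_le_sum_list) auto
  ultimately have "norm z * norm z \<le> norm z * norm (sum_list zs)"
    using Cauchy_Schwarz_ineq2[of z "sum_list zs"]
    by (simp add: power2_norm_eq_inner[symmetric] power2_eq_square)
  then show ?thesis
    by (cases "norm z = 0") (auto simp: mult_le_cancel_left)
qed

text \<open>With \<open>P\<close> and \<open>R\<close> the norms of the two points on the ray, their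
  inner product is \<open>P * R\<close>, while the perturbations cost at most (1/4 + 1/4 + 1/16)
  times \<open>P * R\<close>.\<close>

lemma inner_nonneg_near_ray:
  fixes x y z :: "'a::real_inner"
  assumes "p \<ge> 0" and "q \<ge> 0"
    and x: "norm (p *\<^sub>R z - x) \<le> norm (p *\<^sub>R z) / 4" and y: "norm (q *\<^sub>R z - y) \<le> norm (q *\<^sub>R z) / 4"
  shows "inner x y \<ge> 0"
proof -
  define d e where "d = p *\<^sub>R z - x" and "e = q *\<^sub>R z - y"
  define P R where "P = norm (p *\<^sub>R z)" and "R = norm (q *\<^sub>R z)"
  have PR: "P \<ge> 0" "R \<ge> 0" by (simp_all add: P_def R_def)
  have d: "norm d \<le> P / 4" and e: "norm e \<le> R / 4" using x y by (simp_all add: d_def e_def P_def R_def)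
  have "inner x y = inner (p *\<^sub>R z - d) (q *\<^sub>R z - e)" by (simp add: d_def e_def)
  also have "\<dots> = inner (p *\<^sub>R z) (q *\<^sub>R z) - inner (p *\<^sub>R z) e - inner d (q *\<^sub>R z) + inner d e"
    by (simp add: inner_diff_left inner_diff_right right_diff_distrib)
  finally have eq: "inner x y = \<dots>" .
  have "inner (p *\<^sub>R z) (q *\<^sub>R z) = P * R"
    using assms(1,2) by (simp add: P_def R_def power2_norm_eq_inner[symmetric] power2_eq_square)
  moreover have "\<bar>inner (p *\<^sub>R z) e\<bar> \<le> P * (R / 4)"
    using Cauchy_Schwarz_ineq2[of "p *\<^sub>R z" e] mult_left_mono[OF e PR(1)] by (simp add: P_def)
  moreover have "\<bar>inner d (q *\<^sub>R z)\<bar> \<le> (P / 4) * R"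
    using Cauchy_Schwarz_ineq2[of d "q *\<^sub>R z"] mult_right_mono[OF d PR(2)] by (simp add: R_def)
  moreover have "\<bar>inner d e\<bar> \<le> (P / 4) * (R / 4)"
    using Cauchy_Schwarz_ineq2[of d e] mult_mono[OF d e] PR by simp
  moreover have "P * R \<ge> 0" using PR by simp
  ultimately show ?thesis unfolding eq by simp
qed

lemma real_extension_linear:
  fixes \<iota> :: "'g::ab_group_add \<Rightarrow> 'v::real_vector" and f :: "'g \<Rightarrow> 'w::real_vector"
  assumes "is_realification \<iota>" and "Modules.additive f"
  shows "linear (real_extension \<iota> f)" and "real_extension \<iota> f (\<iota> \<gamma>) = f \<gamma>"
  using theI'[OF realification_universal[OF assms]] unfolding real_extension_def by auto

lemma additive_sum_list:
  assumes "Modules.additive f"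
  shows "f (sum_list xs) = sum_list (map f xs)"
  using assms by (induction xs) (auto simp: additive.zero additive.add)

text \<open>The descent from \<open>s\<close> to \<open>r\<close>: a negative element is replaced by
  a negative summand no larger under the reference charge \<open>Z0\<close>. Measuring with
  \<open>Z0\<close> lets one size bound serve all nearby \<open>Z\<close>.\<close>

lemma stable_support_negative_summand:
  fixes \<iota> :: "'g::ab_group_add \<Rightarrow> 'v::real_normed_vector" and Z Z0 :: "'g \<Rightarrow> complex"
  assumes "is_realification \<iota>" and supp: "stable_support \<iota> Z r s"
    and "quadratic_form Q" and neg: "negative_semidefinite_on {v. real_extension \<iota> Z v = 0} Q"
    and add0: "Modules.additive Z0"
    and s: "s \<subseteq> {\<gamma>. cmod (Z \<gamma>) \<ge> \<epsilon> * norm (\<iota> \<gamma>)}" and "\<epsilon> > 0"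
    and close: "\<And>\<gamma>. cmod (Z \<gamma> - Z0 \<gamma>) \<le> \<epsilon> / 4 * norm (\<iota> \<gamma>)"
    and \<gamma>: "\<gamma> \<in> s" "Q (\<iota> \<gamma>) < 0"
  obtains a where "a \<in> r" and "Q (\<iota> a) < 0" and "cmod (Z0 a) \<le> cmod (Z0 \<gamma>)"
proof -
  have add: "Modules.additive Z" and rs: "r \<subseteq> s"
    and ray: "\<And>l. is_ray l \<Longrightarrow> s \<inter> Z -` l \<subseteq> sgr (r \<inter> Z -` l)"
    using supp unfolding stable_support_def by auto
  have add_\<iota>: "Modules.additive \<iota>" using assms(1) by (simp add: is_realification_def)
  \<comment> \<open>Negativity of \<open>Q (\<iota> \<gamma>)\<close> excludes
    \<open>\<iota> \<gamma> = 0\<close>; the support bound then gives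
    \<open>Z \<gamma> \<noteq> 0\<close>, so \<open>\<gamma>\<close> determines a ray.\<close>
  have "Q 0 = 0"
    using assms(3) unfolding quadratic_form_def by (auto simp: bilinear_lzero)
  then have "\<iota> \<gamma> \<noteq> 0" using \<gamma>(2) by auto
  then have "0 < \<epsilon> * norm (\<iota> \<gamma>)" using \<open>\<epsilon> > 0\<close> by simp
  also have "\<dots> \<le> cmod (Z \<gamma>)" using s \<gamma>(1) by blast
  finally have "Z \<gamma> \<noteq> 0" by simp
  define l where "l = {t *\<^sub>R Z \<gamma> |t. t > 0}"
  have "is_ray l" using \<open>Z \<gamma> \<noteq> 0\<close> unfolding is_ray_def l_def by blast
  moreover have "Z \<gamma> \<in> l" unfolding l_def by (auto intro: exI[of _ 1])
  ultimately have "\<gamma> \<in> sgr (r \<inter> Z -` l)" using ray \<gamma>(1) by blast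
  then obtain as where as: "\<gamma> = sum_list as" "as \<noteq> []" "set as \<subseteq> r \<inter> Z -` l"
    unfolding sgr_def by blast
  have on_ray: "\<exists>t>0. Z a = t *\<^sub>R Z \<gamma>" if "a \<in> set as" for a
    using as(3) that unfolding l_def by auto
  have "\<exists>a\<in>set as. Q (\<iota> a) < 0"
  proof (rule ccontr)
    assume "\<not> ?thesis"
    then have "Q (sum_list (map \<iota> as)) \<ge> 0"
      using as(2) on_ray real_extension_linear[OF assms(1) add]
      by (intro sum_list_on_ray_quadratic_nonneg[OF assms(3) _ neg, of _ "Z \<gamma>"])
        (auto simp: not_less)
    then show False using \<gamma>(2) as(1) by (simp add: additive_sum_list[OF add_\<iota>])
  qed
  then obtain a where a: "a \<in> set as" "Q (\<iota> a) < 0" by blast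
  \<comment> \<open>The support bound turns the error
    \<open>\<epsilon> / 4 * norm (\<iota> c)\<close> into a relative error of 1/4, the tolerance of
    \<open>inner_nonneg_near_ray\<close>.\<close>
  have near: "cmod (Z c - Z0 c) \<le> cmod (Z c) / 4" if "c \<in> set as" for c
  proof -
    have "\<epsilon> * norm (\<iota> c) \<le> cmod (Z c)" using that as(3) rs s by blast
    then show ?thesis using close[of c] by simp
  qed
  have "cmod (Z0 a) \<le> norm (sum_list (map Z0 as))"
  proof (rule norm_le_norm_sum_list)
    fix x y assume "x \<in> set (map Z0 as)" "y \<in> set (map Z0 as)"
    then obtain c d where c: "c \<in> set as" "x = Z0 c" and d: "d \<in> set as" "y = Z0 d" by auto
    obtain p q where "p > 0" "Z c = p *\<^sub>R Z \<gamma>" "q > 0" "Z d = q *\<^sub>R Z \<gamma>"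
      using on_ray c(1) d(1) by blast
    then show "inner x y \<ge> 0"
      using near[OF c(1)] near[OF d(1)] c(2) d(2)
      by (intro inner_nonneg_near_ray[of p q "Z \<gamma>"]) auto
  qed (use a in auto)
  then have "cmod (Z0 a) \<le> cmod (Z0 \<gamma>)" by (simp add: as(1) additive_sum_list[OF add0])
  then show ?thesis using that[of a] a as(3) by blast
qed

section \<open>Propagation along paths\<close>

theorem theorem2p14:
  fixes \<iota> :: "'g::ab_group_add \<Rightarrow> 'v::real_normed_vector"
    and Z :: "'m::topological_space \<Rightarrow> 'g \<Rightarrow> complex"
    and r s :: "'m \<Rightarrow> 'g set"
    and Q :: "'v \<Rightarrow> real"
  assumes "free_of_finite_rank TYPE('g)"
    and "is_realification \<iota>"
    and "path_connected (UNIV :: 'm set)"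
    and "continuous_family \<iota> Z r s"
    and "quadratic_form Q"
    and "\<And>x. negative_semidefinite_on {v. real_extension \<iota> (Z x) v = 0} Q"
    and "\<exists>x. \<forall>\<gamma>\<in>s x. Q (\<iota> \<gamma>) \<ge> 0"
  shows "\<forall>y. \<forall>\<gamma>\<in>s y. Q (\<iota> \<gamma>) \<ge> 0"
proof
  fix y
  have supp: "\<And>x. stable_support \<iota> (Z x) (r x) (s x)" and cont: "continuous_on UNIV Z"
    and unif: "\<And>x. \<exists>\<epsilon>>0. \<exists>U. open U \<and> x \<in> U \<and>
      (\<forall>y\<in>U. s y \<subseteq> {\<gamma>. cmod (Z y \<gamma>) \<ge> \<epsilon> * norm (\<iota> \<gamma>)})"
    and r_open: "\<And>\<gamma>. open {x. \<gamma> \<in> r x}" and s_closed: "\<And>\<gamma>. closed {x. \<gamma> \<in> s x}"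
    using assms(4) unfolding continuous_family_def by blast+
  have add: "Modules.additive (Z x)" and rs: "r x \<subseteq> s x" for x
    using supp[of x] unfolding stable_support_def by blast+
  define bad where "bad x \<longleftrightarrow> (\<exists>\<gamma>\<in>s x. Q (\<iota> \<gamma>) < 0)" for x
  \<comment> \<open>The claim concerns connected subsets \<open>C\<close> of \<open>U\<close>, as
    the space need not be locally connected; below, \<open>C\<close> is the image of an interval
    under the path.\<close>
  have bad_spreads: "\<exists>U. open U \<and> x \<in> U \<and>
      (\<forall>C. connected C \<and> C \<subseteq> U \<and> (\<exists>u\<in>C. bad u) \<longrightarrow> (\<forall>u\<in>C. bad u))" for x
  proof -
    obtain \<epsilon> U1 where \<epsilon>: "\<epsilon> > 0" and U1: "open U1" "x \<in> U1"
      and supp_bound: "\<And>y. y \<in> U1 \<Longrightarrow> s y \<subseteq> {\<gamma>. cmod (Z y \<gamma>) \<ge> \<epsilon> * norm (\<iota> \<gamma>)}"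
      using unif[of x] by blast
    obtain U2 where U2: "open U2" "x \<in> U2"
      and close: "\<And>y \<gamma>. y \<in> U2 \<Longrightarrow> cmod (Z y \<gamma> - Z x \<gamma>) \<le> \<epsilon> / 4 * norm (\<iota> \<gamma>)"
      by (rule eventually_central_charge_close[OF assms(1,2) add cont, of "\<epsilon> / 4" x])
        (use \<epsilon> in simp_all)
    have "\<forall>u\<in>C. bad u" if C: "connected C" "C \<subseteq> U1 \<inter> U2" and "\<exists>u\<in>C. bad u" for C
    proof -
      obtain u0 \<gamma>0 where u0: "u0 \<in> C" "\<gamma>0 \<in> s u0" "Q (\<iota> \<gamma>0) < 0"
        using \<open>\<exists>u\<in>C. bad u\<close> unfolding bad_def by blast
      \<comment> \<open>Closeness within \<open>\<epsilon> / 4\<close> leaves at least 3/4 of the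
        support bound when \<open>Z u\<close> is replaced by \<open>Z x\<close>; the factor 2 is a
        convenient weakening.\<close>
      have size: "\<epsilon> * norm (\<iota> \<gamma>) \<le> 2 * cmod (Z x \<gamma>)" if "u \<in> C" "\<gamma> \<in> s u" for u \<gamma>
      proof -
        have u: "u \<in> U1" "u \<in> U2" using C(2) that(1) by auto
        have 1: "\<epsilon> * norm (\<iota> \<gamma>) \<le> cmod (Z u \<gamma>)" using supp_bound[OF u(1)] that(2) by auto
        have 2: "cmod (Z u \<gamma> - Z x \<gamma>) \<le> \<epsilon> / 4 * norm (\<iota> \<gamma>)" by (rule close[OF u(2)])
        have 3: "cmod (Z u \<gamma>) \<le> cmod (Z x \<gamma>) + cmod (Z u \<gamma> - Z x \<gamma>)"
          by (rule norm_triangle_sub)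
        have "0 \<le> \<epsilon> * norm (\<iota> \<gamma>)" using \<epsilon> by simp
        then show ?thesis using 1 2 3 by simp
      qed
      \<comment> \<open>No condition mentions the varying point \<open>u\<close>. The last two bound
        the norm, which makes \<open>D\<close> finite, and the descent starting from an element of
        \<open>D\<close> stays in \<open>D\<close>.\<close>
      define D where "D = {\<gamma>. Q (\<iota> \<gamma>) < 0 \<and> cmod (Z x \<gamma>) \<le> cmod (Z x \<gamma>0) \<and>
        \<epsilon> * norm (\<iota> \<gamma>) \<le> 2 * cmod (Z x \<gamma>)}"
      have "finite D"
      proof (rule finite_subset)
        show "D \<subseteq> {\<gamma>. norm (\<iota> \<gamma>) \<le> 2 * cmod (Z x \<gamma>0) / \<epsilon>}"
          using \<epsilon> by (auto simp: D_def field_simps)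
      qed (rule realification_discrete[OF assms(1,2)])
      define T where "T = (\<Union>\<gamma>\<in>D. {u. \<gamma> \<in> s u})"
      define T' where "T' = (\<Union>\<gamma>\<in>D. {u. \<gamma> \<in> r u})"
      \<comment> \<open>Within \<open>C\<close> the descent makes membership through
        \<open>s\<close> and through \<open>r\<close> equivalent. The set is thus relatively open as
        a union of open sets, and relatively closed as a finite union of closed ones.\<close>
      have eq: "C \<inter> T = C \<inter> T'"
      proof
        show "C \<inter> T \<subseteq> C \<inter> T'"
        proof
          fix u assume "u \<in> C \<inter> T"
          then obtain \<gamma> where u: "u \<in> C" and \<gamma>: "\<gamma> \<in> D" "\<gamma> \<in> s u" unfolding T_def by blast
          have U: "u \<in> U1" "u \<in> U2" using u C(2) by auto
          have "Q (\<iota> \<gamma>) < 0" using \<gamma>(1) by (simp add: D_def)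
          from stable_support_negative_summand[OF assms(2) supp assms(5,6) add
              supp_bound[OF U(1)] \<epsilon> close[OF U(2)] \<gamma>(2) this]
          obtain a where a: "a \<in> r u" "Q (\<iota> a) < 0" "cmod (Z x a) \<le> cmod (Z x \<gamma>)" by blast
          moreover have "\<epsilon> * norm (\<iota> a) \<le> 2 * cmod (Z x a)" using size[OF u] a(1) rs by blast
          ultimately have "a \<in> D" using \<gamma>(1) by (simp add: D_def)
          then show "u \<in> C \<inter> T'" using a(1) u unfolding T'_def by blast
        qed
        show "C \<inter> T' \<subseteq> C \<inter> T" unfolding T_def T'_def using rs by blast
      qed
      have "open T'" unfolding T'_def by (intro open_UN ballI r_open)
      then have "openin (top_of_set C) (C \<inter> T)" unfolding eq by (rule openin_open_Int)
      moreover have "closed T" unfolding T_def by (intro closed_UN \<open>finite D\<close> ballI s_closed)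
      then have "closedin (top_of_set C) (C \<inter> T)" by (rule closedin_closed_Int)
      moreover have "u0 \<in> C \<inter> T"
        using u0 size[OF u0(1,2)] by (auto simp: T_def D_def)
      ultimately have "C \<inter> T = C" using C(1) unfolding connected_clopen by blast
      then show ?thesis unfolding bad_def T_def D_def by blast
    qed
    then show ?thesis using U1 U2 by (intro exI[of _ "U1 \<inter> U2"]) auto
  qed
  obtain x where x: "\<not> bad x" using assms(7) unfolding bad_def by (auto simp: not_less)
  obtain g where g: "path g" "pathstart g = y" "pathfinish g = x"
    using assms(3) unfolding path_connected_def by blast
  have "\<not> bad y"
  proof
    assume "bad y"
    \<comment> \<open>Badness is carried from the start \<open>y\<close> of the path to its end
      \<open>x\<close>, where it is known to fail.\<close>
    have "bad (g 1)"
    proof (rule connected_induction_simple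
        [where S = "{0..1::real}" and a = 0 and P = "\<lambda>t. bad (g t)"])
      show "bad (g 0)" using \<open>bad y\<close> g(2) by (simp add: pathstart_def)
    next
      fix t :: real assume t: "t \<in> {0..1}"
      obtain U where U: "open U" "g t \<in> U"
        and spread: "\<And>C. connected C \<Longrightarrow> C \<subseteq> U \<Longrightarrow> \<exists>u\<in>C. bad u \<Longrightarrow> \<forall>u\<in>C. bad u"
        using bad_spreads[of "g t"] by blast
      have cg: "continuous_on {0..1} g" using g(1) by (simp add: path_def)
      then have "openin (top_of_set {0..1}) ({0..1} \<inter> g -` U)"
        using U(1) by (simp add: continuous_openin_preimage_gen)
      then obtain d where d: "d > 0" "ball t d \<inter> {0..1} \<subseteq> {0..1} \<inter> g -` U"
        using t U(2) unfolding openin_contains_ball by blast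
      \<comment> \<open>Near \<open>t\<close> the parameters form an interval, so their image is a
        connected subset of \<open>U\<close>, to which \<open>spread\<close> applies.\<close>
      have "convex (ball t d \<inter> {0..1})" by (intro convex_Int) auto
      then have "connected (g ` (ball t d \<inter> {0..1}))"
        by (intro connected_continuous_image continuous_on_subset[OF cg] convex_connected) auto
      then have "\<forall>a\<in>ball t d \<inter> {0..1}. \<forall>b\<in>ball t d \<inter> {0..1}. bad (g a) \<longrightarrow> bad (g b)"
        using spread[of "g ` (ball t d \<inter> {0..1})"] d(2) by blast
      moreover have "openin (top_of_set {0..1}) (ball t d \<inter> {0..1})"
        by (subst Int_commute) (rule openin_open_Int[OF open_ball])
      moreover have "t \<in> ball t d \<inter> {0..1}" using d(1) t by simp
      ultimately show "\<exists>T. openin (top_of_set {0..1}) T \<and> t \<in> T \<and>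
          (\<forall>a\<in>T. \<forall>b\<in>T. bad (g a) \<longrightarrow> bad (g b))"
        by blast
    qed auto
    then show False using x g(3) by (simp add: pathfinish_def)
  qed
  then show "\<forall>\<gamma>\<in>s y. Q (\<iota> \<gamma>) \<ge> 0" unfolding bad_def by (auto simp: not_less)
qed

end
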